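(* Let $h:\mathbb{R}^n\to\mathbb{R}\cup\{+\infty\}$ be a closed proper convex function, let $A$ be an $m\times n$ real matrix, let $\sigma>0$ be a scalar, and define $\phi:\mathbb{R}^n\to\mathbb{R}\cup\{+\infty\}$ by $\phi(x)=h(x)+\frac{\sigma}{2}\|Ax\|^2$. Then for all $x,x'\in\mathbb{R}^n$ and all $w\in\partial\phi(x)$, $$\phi(x')\ \ge\ \phi(x)+\langle w,\,x'-x\rangle+\frac{\sigma}{2}\|Ax'-Ax\|^2 .$$ In particular, if $x^*\in\mathbb{R}^n$ minimizes $\phi$, then for all $x'\in\mathbb{R}^n$, $$\phi(x')\ \ge\ \phi(x^* )+\frac{\sigma}{2}\|Ax'-Ax^*\|^2 .$$
   Context: $\|\cdot\|$ and $\langle\cdot,\cdot\rangle$ are the Euclidean norm and inner product. $\partial\phi$ denotes the convex subdifferential. A closed function is a lower semicontinuous one. *)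

theory Defs
  imports "HOL-Analysis.Analysis"
begin

definition proper_fun :: "('a \<Rightarrow> ereal) \<Rightarrow> bool" where
  "proper_fun f \<longleftrightarrow> (\<forall>x. f x \<noteq> -\<infinity>) \<and> (\<exists>x. f x \<noteq> \<infinity>)"

definition lower_semicontinuous :: "('a::topological_space \<Rightarrow> ereal) \<Rightarrow> bool" where
  "lower_semicontinuous f \<longleftrightarrow> (\<forall>x. f x \<le> Liminf (at x) f)"

(* The library's convex_on covers only real-valued functions.  In ereal, 0 * \<infinity> = 0,
   so the cases u = 0 and v = 0 below are trivially true. *)
definition convex_fun :: "('a::real_vector \<Rightarrow> ereal) \<Rightarrow> bool" where
  "convex_fun f \<longleftrightarrow>
     (\<forall>x y u v. 0 \<le> u \<longrightarrow> 0 \<le> v \<longrightarrow> u + v = 1 \<longrightarrow>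
        f (u *\<^sub>R x + v *\<^sub>R y) \<le> ereal u * f x + ereal v * f y)"

(* For proper f this is empty wherever f x = \<infinity>: such an x would force f to be
   identically \<infinity>. *)
definition subdifferential :: "('a::real_inner \<Rightarrow> ereal) \<Rightarrow> 'a \<Rightarrow> 'a set" where
  "subdifferential f x = {w. \<forall>y. f y \<ge> f x + ereal (w \<bullet> (y - x))}"

end

theory Submission
  imports Defs
begin

text \<open>The quadratic term makes \<open>\<phi>\<close> satisfy the convexity inequality with an extra
  \<open>- (\<sigma> / 2) t (1 - t) \<parallel>A x' - A x\<parallel>\<^sup>2\<close> on the right. Combining it at the point
  \<open>(1 - t) x + t x'\<close> with the subgradient inequality there, dividing by \<open>t\<close> and letting
  \<open>t\<close> tend to \<open>0\<close> gives the claim. A minimizer has \<open>0\<close> as a subgradient.\<close>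

text \<open>With \<open>v = 1 - u\<close>, both \<open>u - u\<^sup>2\<close> and
  \<open>v - v\<^sup>2\<close> equal \<open>u * v\<close>, so the deficit in the squares and the
  cross term \<open>2 * (u * v) * (p \<bullet> q)\<close> assemble into one square of
  \<open>q - p\<close>.\<close>

lemma norm_sq_convex_combination:
  fixes p q :: "'a::real_inner"
  assumes "u + v = 1"
  shows "(norm (u *\<^sub>R p + v *\<^sub>R q))\<^sup>2
       = u * (norm p)\<^sup>2 + v * (norm q)\<^sup>2 - u * v * (norm (q - p))\<^sup>2"
proof -
  have v: "v = 1 - u" using assms by simp
  show ?thesis
    unfolding v power2_norm_eq_inner
    by (simp add: algebra_simps inner_commute)
qed

text \<open>The quadratic part satisfies its convexity relation as an exact identity with a known
  defect; adding the inequality for \<open>h\<close> carries this defect over to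
  \<open>\<phi>\<close>.\<close>

lemma convex_fun_add_quadratic:
  fixes h :: "'a::real_vector \<Rightarrow> ereal" and g :: "'a \<Rightarrow> 'b::real_inner"
  assumes "convex_fun h" and "linear g"
    and \<phi>: "\<And>x. \<phi> x = h x + ereal (c * (norm (g x))\<^sup>2)"
    and uv: "0 \<le> u" "0 \<le> v" "u + v = 1"
    and x: "\<phi> x = ereal a" and y: "\<phi> y = ereal b"
  shows "\<phi> (u *\<^sub>R x + v *\<^sub>R y) \<le> ereal (u * a + v * b - c * (u * v) * (norm (g y - g x))\<^sup>2)"
proof -
  \<comment> \<open>The quadratic term is real, so a finite value of \<open>\<phi>\<close> forces a
    finite value of \<open>h\<close>. The right-hand side of the convexity inequality then becomes
    real arithmetic.\<close>
  have hx: "h x = ereal (a - c * (norm (g x))\<^sup>2)"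
    using x \<phi>[of x] by (cases "h x") auto
  have hy: "h y = ereal (b - c * (norm (g y))\<^sup>2)"
    using y \<phi>[of y] by (cases "h y") auto
  have "g (u *\<^sub>R x + v *\<^sub>R y) = u *\<^sub>R g x + v *\<^sub>R g y"
    using \<open>linear g\<close> by (simp add: linear_add linear_scale)
  then have norm: "(norm (g (u *\<^sub>R x + v *\<^sub>R y)))\<^sup>2
      = u * (norm (g x))\<^sup>2 + v * (norm (g y))\<^sup>2 - u * v * (norm (g y - g x))\<^sup>2"
    using norm_sq_convex_combination[OF uv(3)] by simp
  have "h (u *\<^sub>R x + v *\<^sub>R y) \<le> ereal u * h x + ereal v * h y"
    using \<open>convex_fun h\<close> uv unfolding convex_fun_def by blast
  then have "\<phi> (u *\<^sub>R x + v *\<^sub>R y)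
      \<le> (ereal u * h x + ereal v * h y) + ereal (c * (norm (g (u *\<^sub>R x + v *\<^sub>R y)))\<^sup>2)"
    unfolding \<phi> by (rule add_right_mono)
  also have "\<dots> = ereal (u * a + v * b - c * (u * v) * (norm (g y - g x))\<^sup>2)"
    unfolding norm hx hy by (simp add: algebra_simps)
  finally show ?thesis .
qed

lemma subgradient_add_quadratic:
  fixes h :: "'a::real_inner \<Rightarrow> ereal" and g :: "'a \<Rightarrow> 'b::real_inner"
  assumes "proper_fun h" and "convex_fun h" and "linear g"
    and \<phi>: "\<And>x. \<phi> x = h x + ereal (c * (norm (g x))\<^sup>2)"
    and w: "w \<in> subdifferential \<phi> x"
  shows "\<phi> x + ereal (w \<bullet> (x' - x)) + ereal (c * (norm (g x' - g x))\<^sup>2) \<le> \<phi> x'"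
proof (cases "\<phi> x' = \<infinity>")
  case False
  have not_minf: "\<phi> y \<noteq> -\<infinity>" for y
    using \<open>proper_fun h\<close> unfolding proper_fun_def \<phi> by (cases "h y") auto
  have sub: "\<phi> x + ereal (w \<bullet> (y - x)) \<le> \<phi> y" for y
    using w unfolding subdifferential_def by auto
  obtain b where b: "\<phi> x' = ereal b"
    using False not_minf[of x'] by (cases "\<phi> x'") auto
  \<comment> \<open>The subgradient inequality at \<open>x'\<close> bounds \<open>\<phi> x\<close>
    above by a real number, which excludes \<open>\<infinity>\<close>.\<close>
  obtain a where a: "\<phi> x = ereal a"
    using sub[of x'] b not_minf[of x] by (cases "\<phi> x") auto
  define k where "k = c * (norm (g x' - g x))\<^sup>2"
  have "k \<le> b - a - w \<bullet> (x' - x)"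
  \<comment> \<open>This rule replaces the limit: \<open>k \<le> B\<close> follows once
    \<open>u * k \<le> B\<close> for every \<open>u\<close> strictly between 0 and 1. Here
    \<open>u\<close> is the weight of \<open>x\<close>, and \<open>v = 1 - u\<close> is the step
    towards \<open>x'\<close>.\<close>
  proof (rule field_le_mult_one_interval)
    fix u :: real
    assume u: "0 < u" "u < 1"
    define v where "v = 1 - u"
    have v: "0 < v" "u = 1 - v" using u by (auto simp: v_def)
    let ?y = "u *\<^sub>R x + v *\<^sub>R x'"
    have "?y - x = v *\<^sub>R (x' - x)"
      unfolding v(2) by (simp add: algebra_simps)
    then have "ereal (a + v * (w \<bullet> (x' - x))) \<le> \<phi> ?y"
      using sub[of ?y] a by simp
    also have "\<dots> \<le> ereal (u * a + v * b - c * (u * v) * (norm (g x' - g x))\<^sup>2)"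
      using convex_fun_add_quadratic[OF \<open>convex_fun h\<close> \<open>linear g\<close> \<phi> _ _ _ a b] u v by simp
    finally have "a + v * (w \<bullet> (x' - x)) \<le> u * a + v * b - u * v * k"
      by (simp add: k_def mult_ac)
    \<comment> \<open>Since \<open>u * a - a = - v * a\<close>, every remaining term contains the
      factor \<open>v\<close>, which is positive and cancels.\<close>
    then have "v * (u * k) \<le> v * (b - a - w \<bullet> (x' - x))"
      unfolding v(2) by (simp add: algebra_simps)
    then show "u * k \<le> b - a - w \<bullet> (x' - x)"
      using v(1) by simp
  qed
  then show ?thesis
    by (simp add: a b k_def)
qed simp

lemma zero_in_subdifferential_arg_min:
  assumes "is_arg_min f (\<lambda>_. True) x"
  shows "0 \<in> subdifferential f x"
  using assms by (auto simp: subdifferential_def is_arg_min_linorder zero_ereal_def[symmetric])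

theorem lemma8:
  fixes h \<phi> :: "real ^ 'n \<Rightarrow> ereal"
    and A :: "real ^ 'n ^ 'm"
    and \<sigma> :: real
  assumes "proper_fun h" and "lower_semicontinuous h" and "convex_fun h"
    and "\<sigma> > 0"
    and "\<And>x. \<phi> x = h x + ereal (\<sigma> / 2 * (norm (A *v x))\<^sup>2)"
  shows "(\<forall>x x' w. w \<in> subdifferential \<phi> x \<longrightarrow>
            \<phi> x' \<ge> \<phi> x + ereal (w \<bullet> (x' - x))
                        + ereal (\<sigma> / 2 * (norm (A *v x' - A *v x))\<^sup>2)) \<and>
         (\<forall>xstar. is_arg_min \<phi> (\<lambda>_. True) xstar \<longrightarrow>
            (\<forall>x'. \<phi> x' \<ge> \<phi> xstar + ereal (\<sigma> / 2 * (norm (A *v x' - A *v xstar))\<^sup>2)))"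
proof -
  note main = subgradient_add_quadratic[OF assms(1,3) matrix_vector_mul_linear[of A] assms(5)]
  show ?thesis
  proof (intro conjI allI impI)
    fix x x' w
    assume "w \<in> subdifferential \<phi> x"
    then show "\<phi> x' \<ge> \<phi> x + ereal (w \<bullet> (x' - x)) + ereal (\<sigma> / 2 * (norm (A *v x' - A *v x))\<^sup>2)"
      by (rule main)
  next
    fix xstar x'
    assume "is_arg_min \<phi> (\<lambda>_. True) xstar"
    from main[OF zero_in_subdifferential_arg_min[OF this], of x']
    show "\<phi> x' \<ge> \<phi> xstar + ereal (\<sigma> / 2 * (norm (A *v x' - A *v xstar))\<^sup>2)"
      \<comment> \<open>For the subgradient 0 the linear term is \<open>ereal 0\<close>; folding it
        to \<open>0\<close> lets it vanish from the sum.\<close>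
      by (simp add: zero_ereal_def[symmetric])
  qed
qed

end
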